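(* Let $f:\mathbb{R}^d\to\mathbb{R}$ be convex and continuously differentiable, and suppose $f$ has a minimizer. Let $\theta,\gamma,\nu>0$ satisfy $$4\nu\theta(1+\gamma)^2=\gamma,\qquad 1+2\gamma+\frac{2\gamma\theta^2}{(1+\theta)^2}\le\frac{\theta}{1+\theta}+\frac{\theta^2}{(1+\theta)^2}.$$ Let $x_0\in\mathbb{R}^d$, $\eta_0>0$, $K\in\{1,2,\dots\}$, and let $x_k,\overline{x}_k,\tilde{x}_k,\lambda_k,\eta_k,H_k$ be generated by Accelerated GRAAL (defined in the context). Then for all $x\in\mathbb{R}^d$ and all $k\in\{1,\dots,K-1\}$, $$\Psi_{k+1}(x)\le\Psi_k(x)-\frac{\gamma\theta}{2}\eta_k^2\|\nabla f(\tilde{x}_k)\|^2-\frac{1}{4(1+\gamma)}\eta_k D_f(\overline{x}_k;\tilde{x}_k),$$ where $$\Psi_k(x)=\tfrac12\|x_k-x\|^2+H_{k-1}\big(f(\overline{x}_k)-f(x)\big)+\frac{\theta\eta_k\eta_{k-1}}{\lambda_k}D_f(\overline{x}_{k-1};\tilde{x}_{k-1})+\frac{\gamma\theta}{2}\|x_k-x_{k-1}\|^2 .$$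
   Context: $\mathbb{R}^d$ is a finite-dimensional Euclidean space with inner product $\langle\cdot,\cdot\rangle$ and norm $\|\cdot\|$. The Bregman divergence of $f$ is $D_f(x;z)=f(x)-f(z)-\langle\nabla f(z),x-z\rangle$ (also written $D_f(x,z)$). The curvature estimator is $\Lambda(x;z)=\frac{2D_f(x;z)}{\|\nabla f(x)-\nabla f(z)\|^2}$ if $\nabla f(x)\ne\nabla f(z)$ and $\Lambda(x;z)=+\infty$ if $\nabla f(x)=\nabla f(z)$. Accelerated GRAAL with parameters $\theta,\gamma,\nu$, starting point $x_0$, initial stepsize $\eta_0>0$ and number of iterations $K$: set $\alpha_0=\beta_0=1$, $H_0=H_{-1}=\eta_{-1}=\eta_0$, $\tilde{x}_0=\overline{x}_0=x_0$. For $k=0,1,\dots,K-1$ compute, in this order: $\alpha_{k+1}=\frac{(1+\gamma)\eta_k}{H_k+(1+\gamma)\eta_k}$; $x_{k+1}=x_k-\eta_k\nabla f(\tilde{x}_k)$; $\overline{x}_{k+1}=\beta_k\tilde{x}_k+(1-\beta_k)\overline{x}_k$; $\hat{x}_{k+1}=x_{k+1}+\theta(x_{k+1}-x_k)$; $\tilde{x}_{k+1}=\alpha_{k+1}\hat{x}_{k+1}+(1-\alpha_{k+1})\overline{x}_{k+1}$; $\lambda_{k+1}=\min\{\Lambda(\overline{x}_{k+1};\tilde{x}_k),\Lambda(\overline{x}_{k+1};\tilde{x}_{k+1})\}$; $\eta_{k+1}=\min\{(1+\gamma)\eta_k,\ \nu H_{k-1}\lambda_{k+1}/\eta_{k-1}\}$;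 $H_{k+1}=H_k+\eta_{k+1}$; $\beta_{k+1}=\frac{\eta_{k+1}}{\alpha_{k+1}H_{k+1}}$. The output is $\overline{x}_K$. Conventions: if $\lambda_{k+1}=+\infty$ then $\nu H_{k-1}\lambda_{k+1}/\eta_{k-1}=+\infty$ (so $\eta_{k+1}=(1+\gamma)\eta_k$), and $1/\lambda_{k+1}=0$. *)

theory Defs
  imports "HOL-Analysis.Analysis"
begin

definition gradient :: "('a::real_inner \<Rightarrow> real) \<Rightarrow> 'a \<Rightarrow> 'a" where
  "gradient f x = (THE D. GDERIV f x :> D)"

definition bregman :: "('a::real_inner \<Rightarrow> real) \<Rightarrow> 'a \<Rightarrow> 'a \<Rightarrow> real" where
  "bregman f x z = f x - f z - gradient f z \<bullet> (x - z)"

definition curvature :: "('a::real_inner \<Rightarrow> real) \<Rightarrow> 'a \<Rightarrow> 'a \<Rightarrow> ereal" where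
  "curvature f x z =
     (if gradient f x = gradient f z then \<infinity>
      else ereal (2 * bregman f x z / (norm (gradient f x - gradient f z))\<^sup>2))"

text \<open>
  The state after \<open>k\<close> iterations of Accelerated GRAAL. The components ending in
  \<open>_prev\<close> hold the values with index \<open>k - 1\<close>, so that the indices \<open>-1\<close> of the
  initialization need no special treatment.
\<close>

record 'a graal_state =
  it_x :: 'a
  it_xbar :: 'a
  it_xtilde :: 'a
  it_alpha :: real
  it_beta :: real
  it_lambda :: ereal
  it_eta :: real
  it_eta_prev :: real
  it_H :: real
  it_H_prev :: real

text \<open>
  The algorithm has no \<open>\<lambda>\<^sub>0\<close>; the value given here is a dummy that is never read.
\<close>

definition graal_init :: "'a \<Rightarrow> real \<Rightarrow> 'a graal_state" where
  "graal_init x0 \<eta>0 =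
     \<lparr>it_x = x0, it_xbar = x0, it_xtilde = x0, it_alpha = 1, it_beta = 1,
      it_lambda = \<infinity>, it_eta = \<eta>0, it_eta_prev = \<eta>0, it_H = \<eta>0, it_H_prev = \<eta>0\<rparr>"

text \<open>
  The minimum defining the new stepsize is taken in the extended reals, where a positive
  number times \<open>\<infinity>\<close> is \<open>\<infinity>\<close>. As its first argument is finite and curvature estimates of
  convex functions are nonnegative, the minimum is finite.
\<close>

definition graal_step ::
  "('a::real_inner \<Rightarrow> real) \<Rightarrow> real \<Rightarrow> real \<Rightarrow> real \<Rightarrow> 'a graal_state \<Rightarrow> 'a graal_state" where
  "graal_step f \<theta> \<gamma> \<nu> s =
     (let \<alpha> = (1 + \<gamma>) * it_eta s / (it_H s + (1 + \<gamma>) * it_eta s);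
          x = it_x s - it_eta s *\<^sub>R gradient f (it_xtilde s);
          xbar = it_beta s *\<^sub>R it_xtilde s + (1 - it_beta s) *\<^sub>R it_xbar s;
          xhat = x + \<theta> *\<^sub>R (x - it_x s);
          xtilde = \<alpha> *\<^sub>R xhat + (1 - \<alpha>) *\<^sub>R xbar;
          lam = min (curvature f xbar (it_xtilde s)) (curvature f xbar xtilde);
          \<eta> = real_of_ereal (min (ereal ((1 + \<gamma>) * it_eta s))
                (ereal (\<nu> * it_H_prev s) * lam / ereal (it_eta_prev s)));
          H = it_H s + \<eta>;
          \<beta> = \<eta> / (\<alpha> * H)
      in \<lparr>it_x = x, it_xbar = xbar, it_xtilde = xtilde, it_alpha = \<alpha>, it_beta = \<beta>,
          it_lambda = lam, it_eta = \<eta>, it_eta_prev = it_eta s, it_H = H, it_H_prev = it_H s\<rparr>)"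

text \<open>
  The iterates do not depend on the number \<open>K\<close> of iterations: a run with \<open>K\<close> iterations
  consists of the states with index at most \<open>K\<close>.
\<close>

primrec graal ::
  "('a::real_inner \<Rightarrow> real) \<Rightarrow> real \<Rightarrow> real \<Rightarrow> real \<Rightarrow> 'a \<Rightarrow> real \<Rightarrow> nat \<Rightarrow> 'a graal_state" where
  "graal f \<theta> \<gamma> \<nu> x0 \<eta>0 0 = graal_init x0 \<eta>0"
| "graal f \<theta> \<gamma> \<nu> x0 \<eta>0 (Suc k) = graal_step f \<theta> \<gamma> \<nu> (graal f \<theta> \<gamma> \<nu> x0 \<eta>0 k)"

text \<open>
  The potential function along a run \<open>S\<close>, meant for \<open>k \<ge> 1\<close>. In the extended reals
  \<open>1 / \<infinity> = 0\<close>. For convex differentiable \<open>f\<close> the curvature estimates are never zero.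
\<close>

definition graal_potential ::
  "('a::real_inner \<Rightarrow> real) \<Rightarrow> real \<Rightarrow> real \<Rightarrow> (nat \<Rightarrow> 'a graal_state) \<Rightarrow> nat \<Rightarrow> 'a \<Rightarrow> real" where
  "graal_potential f \<theta> \<gamma> S k x =
     1 / 2 * (norm (it_x (S k) - x))\<^sup>2
     + it_H (S (k - 1)) * (f (it_xbar (S k)) - f x)
     + \<theta> * it_eta (S k) * it_eta (S (k - 1)) * real_of_ereal (1 / it_lambda (S k))
         * bregman f (it_xbar (S (k - 1))) (it_xtilde (S (k - 1)))
     + \<gamma> * \<theta> / 2 * (norm (it_x (S k) - it_x (S (k - 1))))\<^sup>2"

end

theory Submission imports Defs begin

text \<open>
  Put \<open>a = \<eta>\<^sub>k \<nabla>f(xtilde\<^sub>k)\<close>, \<open>b = \<eta>\<^bsub>k-1\<^esub> \<nabla>f(xtilde\<^bsub>k-1\<^esub>)\<close> and \<open>r = \<eta>\<^sub>k / \<eta>\<^bsub>k-1\<^esub>\<close>. Expanding the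
  squared distance to \<open>x\<close> and using convexity at \<open>xtilde\<^sub>k\<close>, the potential decreases up to the error
  \<open>\<parallel>a\<parallel>\<^sup>2 / 2 - \<theta> a \<bullet> b\<close>, with a gain proportional to \<open>D(xbar\<^sub>k; xtilde\<^sub>k)\<close>. To control the cross term, insert
  the gradient at \<open>xbar\<^sub>k\<close>: with \<open>w = \<eta>\<^bsub>k-1\<^esub> \<nabla>f(xbar\<^sub>k)\<close> and \<open>a = r (w + d)\<close>, polarization gives
  \<open>- r w \<bullet> b = r/2 (\<parallel>w - b\<parallel>\<^sup>2 - \<parallel>w\<parallel>\<^sup>2 - \<parallel>b\<parallel>\<^sup>2)\<close>, while \<open>- r d \<bullet> b\<close> goes into \<open>\<parallel>b\<parallel>\<^sup>2\<close> and \<open>r\<^sup>2 \<parallel>d\<parallel>\<^sup>2\<close> by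
  Young's inequality. By the choice of \<open>\<lambda>\<^sub>k\<close>, \<open>\<parallel>w - b\<parallel>\<^sup>2\<close> is paid by the Bregman term of the potential,
  and by the choice of \<open>\<eta>\<^sub>k\<close>, \<open>r\<^sup>2 \<parallel>d\<parallel>\<^sup>2\<close> is paid by the gain.
\<close>

section \<open>Gradients and Bregman divergences of convex functions\<close>

text \<open>Riesz representation in coordinates. As \<open>gradient\<close> is a definite
  description, uniqueness is needed besides existence.\<close>

lemma differentiable_imp_GDERIV:
  fixes f :: "'a::euclidean_space \<Rightarrow> real"
  assumes "f differentiable (at z)"
  shows "GDERIV f z :> gradient f z"
proof -
  obtain f' where f': "(f has_derivative f') (at z)"
    using assms by (auto simp: differentiable_def)
  interpret f': bounded_linear f'
    using f' by (rule has_derivative_bounded_linear)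
  define D where "D = (\<Sum>b\<in>Basis. f' b *\<^sub>R b)"
  have "f' h = h \<bullet> D" for h
  proof -
    have "f' h = f' (\<Sum>b\<in>Basis. (h \<bullet> b) *\<^sub>R b)"
      by (simp add: euclidean_representation)
    also have "\<dots> = h \<bullet> D"
      by (simp add: f'.sum f'.scaleR D_def inner_sum_right mult.commute)
    finally show ?thesis .
  qed
  then have "f' = (\<lambda>h. h \<bullet> D)" by blast
  with f' have D: "GDERIV f z :> D" by (simp add: gderiv_def)
  have unique: "E = D" if "GDERIV f z :> E" for E
  proof -
    have "(\<lambda>h. h \<bullet> E) = (\<lambda>h. h \<bullet> D)"
      using that D unfolding gderiv_def by (rule has_derivative_unique)
    then have "\<forall>h. h \<bullet> E = h \<bullet> D" by (simp add: fun_eq_iff)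
    then show ?thesis by (simp only: vector_eq_ldot)
  qed
  have "gradient f z = D"
    unfolding gradient_def using D unique by (rule the_equality)
  then show ?thesis using D by simp
qed

text \<open>Along the line through \<open>z\<close> and \<open>y\<close> this is the tangent
  inequality for convex functions of one variable.\<close>

lemma bregman_nonneg:
  fixes f :: "'a::euclidean_space \<Rightarrow> real"
  assumes cvx: "convex_on UNIV f" and diff: "f differentiable (at z)"
  shows "0 \<le> bregman f y z"
proof -
  define p where "p t = z + t *\<^sub>R (y - z)" for t
  have "p ((1 - u) * s + u * t) = (1 - u) *\<^sub>R p s + u *\<^sub>R p t" for u s t
    by (simp add: p_def algebra_simps)
  then have cvx_line: "convex_on UNIV (f \<circ> p)"
    using cvx by (intro convex_onI) (auto simp: convex_on_def)
  have deriv_line: "((f \<circ> p) has_field_derivative gradient f z \<bullet> (y - z)) (at 0)"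
  proof -
    have "(p has_derivative (\<lambda>t. t *\<^sub>R (y - z))) (at 0)"
      unfolding p_def by (auto intro!: derivative_eq_intros)
    moreover have "(f has_derivative (\<lambda>h. h \<bullet> gradient f z)) (at (p 0))"
      using differentiable_imp_GDERIV[OF diff] by (simp add: p_def gderiv_def)
    ultimately have "(f \<circ> p has_derivative (\<lambda>h. h \<bullet> gradient f z) \<circ> (\<lambda>t. t *\<^sub>R (y - z))) (at 0)"
      by (rule diff_chain_at)
    then show ?thesis
      by (simp add: has_field_derivative_def o_def inner_commute mult_commute_abs)
  qed
  have "(f \<circ> p) 1 - (f \<circ> p) 0 \<ge> gradient f z \<bullet> (y - z) * (1 - 0)"
    by (rule convex_on_imp_above_tangent[OF cvx_line connected_UNIV _ _ deriv_line]) simp_all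
  moreover have "p 1 = y" "p 0 = z" by (simp_all add: p_def)
  ultimately show ?thesis by (simp add: bregman_def)
qed

text \<open>Otherwise \<open>y\<close> minimizes the nonnegative function
  \<open>bregman f u z\<close> of \<open>u\<close>, so the gradient of that function at
  \<open>y\<close>, which is the difference of the two gradients of \<open>f\<close>,
  vanishes.\<close>

lemma bregman_pos:
  fixes f :: "'a::euclidean_space \<Rightarrow> real"
  assumes cvx: "convex_on UNIV f" and diff: "\<And>u. f differentiable (at u)"
    and neq: "gradient f y \<noteq> gradient f z"
  shows "0 < bregman f y z"
proof (rule ccontr)
  assume "\<not> 0 < bregman f y z"
  then have "bregman f y z = 0" using bregman_nonneg[OF cvx diff, of y z] by simp
  then have min: "bregman f y z \<le> bregman f u z" for u
    using bregman_nonneg[OF cvx diff, of u z] by simp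
  have "(f has_derivative (\<lambda>h. h \<bullet> gradient f y)) (at y)"
    using differentiable_imp_GDERIV[OF diff] by (simp add: gderiv_def)
  then have "((\<lambda>u. bregman f u z) has_derivative (\<lambda>h. h \<bullet> gradient f y - gradient f z \<bullet> h)) (at y)"
    unfolding bregman_def by (auto intro!: derivative_eq_intros)
  from differential_zero_maxmin[OF _ open_UNIV this] min
  have "(\<lambda>h. h \<bullet> gradient f y - gradient f z \<bullet> h) = (\<lambda>h. 0)" by auto
  then have "(gradient f y - gradient f z) \<bullet> gradient f y
      - gradient f z \<bullet> (gradient f y - gradient f z) = 0" by metis
  then have "(gradient f y - gradient f z) \<bullet> (gradient f y - gradient f z) = 0"
    by (simp add: inner_commute algebra_simps)
  then show False using neq by simp
qed

text \<open>The divergence is convex in its first argument and vanishes at \<open>z\<close>. As each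
  new \<open>it_xbar\<close> averages the old \<open>it_xtilde\<close> and \<open>it_xbar\<close>,
  the Bregman term of the potential, taken at the old point, also controls the new one.\<close>

lemma bregman_convex_le:
  assumes cvx: "convex_on UNIV f" and nonneg: "0 \<le> bregman f y z" and "0 \<le> b" "b \<le> 1"
  shows "bregman f (b *\<^sub>R z + (1 - b) *\<^sub>R y) z \<le> bregman f y z"
proof -
  have "f (b *\<^sub>R z + (1 - b) *\<^sub>R y) \<le> b * f z + (1 - b) * f y"
    using assms by (auto simp: convex_on_def)
  then have "bregman f (b *\<^sub>R z + (1 - b) *\<^sub>R y) z \<le> (1 - b) * bregman f y z"
    by (simp add: bregman_def algebra_simps)
  also have "\<dots> \<le> 1 * bregman f y z"
    using assms by (intro mult_right_mono) auto
  finally show ?thesis by simp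
qed

section \<open>Curvature estimates and stepsizes\<close>

lemma curvature_pos:
  fixes f :: "'a::euclidean_space \<Rightarrow> real"
  assumes "convex_on UNIV f" and "\<And>u. f differentiable (at u)"
  shows "0 < curvature f y z"
proof (cases "gradient f y = gradient f z")
  case True
  then show ?thesis by (simp add: curvature_def)
next
  case False
  then show ?thesis using bregman_pos[OF assms False] by (simp add: curvature_def)
qed

text \<open>Stating the curvature bound through \<open>1 / l\<close> covers
  \<open>l = \<infinity>\<close>: the reciprocal is then 0 and the gradients coincide.\<close>

lemma norm_gradient_diff_le:
  fixes f :: "'a::euclidean_space \<Rightarrow> real"
  assumes cvx: "convex_on UNIV f" and diff: "\<And>u. f differentiable (at u)"
    and l: "0 < l" "l \<le> curvature f y z"
  shows "(norm (gradient f y - gradient f z))\<^sup>2 \<le> 2 * real_of_ereal (1 / l) * bregman f y z"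
proof (cases "gradient f y = gradient f z")
  case True
  have "0 \<le> real_of_ereal (1 / l)" using l by (cases l) (auto simp: one_ereal_def)
  then show ?thesis using True bregman_nonneg[OF cvx diff, of y z] by simp
next
  case False
  with l obtain m where m: "l = ereal m" "0 < m"
    by (cases l) (auto simp: curvature_def)
  then have "m \<le> 2 * bregman f y z / (norm (gradient f y - gradient f z))\<^sup>2"
    using l False by (simp add: curvature_def)
  then have "m * (norm (gradient f y - gradient f z))\<^sup>2 \<le> 2 * bregman f y z"
    using False by (simp add: field_simps)
  then show ?thesis using m by (simp add: one_ereal_def field_simps)
qed

text \<open>Here \<open>p\<close> is the growth cap and \<open>c\<close> the factor of the curvature
  estimate. The product of \<eta> with the reciprocal of \<open>l\<close> stays meaningful for
  \<open>l = \<infinity>\<close>, where the cap alone decides.\<close>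

lemma stepsize_bounds:
  fixes l :: ereal and c p :: real
  assumes "0 < l" "0 < c" "0 < p"
  defines "\<eta> \<equiv> real_of_ereal (min (ereal p) (ereal c * l))"
  shows "0 < \<eta>" "\<eta> \<le> p" "\<eta> * real_of_ereal (1 / l) \<le> c" "0 \<le> real_of_ereal (1 / l)"
proof -
  have "0 < \<eta> \<and> \<eta> \<le> p \<and> \<eta> * real_of_ereal (1 / l) \<le> c \<and> 0 \<le> real_of_ereal (1 / l)"
  proof (cases l)
    case (real m)
    then have "\<eta> = min p (c * m)" by (simp add: \<eta>_def flip: ereal_min)
    moreover have "real_of_ereal (1 / l) = 1 / m" using real assms(1) by (simp add: one_ereal_def)
    moreover have "0 < m" using real assms(1) by simp
    ultimately show ?thesis using assms(2,3) by (simp add: pos_divide_le_eq)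
  next
    case PInf
    then show ?thesis using assms(2,3) by (simp add: \<eta>_def)
  next
    case MInf
    then show ?thesis using assms(1) by simp
  qed
  then show "0 < \<eta>" "\<eta> \<le> p" "\<eta> * real_of_ereal (1 / l) \<le> c" "0 \<le> real_of_ereal (1 / l)"
    by auto
qed

section \<open>Inequalities behind the descent estimate\<close>

text \<open>
  The condition on the parameters forces \<open>2 \<gamma> \<le> 1 / 2\<close> and \<open>2 \<gamma> \<theta> \<le> 2 / 3 \<theta> - 1\<close>, and the product of
  the two resulting bounds is \<open>\<theta>\<close>.
\<close>

lemma parameter_bound:
  fixes \<theta> \<gamma> :: real
  assumes "\<theta> > 0" and "\<gamma> > 0"
    and cond: "1 + 2 * \<gamma> + 2 * \<gamma> * \<theta>\<^sup>2 / (1 + \<theta>)\<^sup>2 \<le> \<theta> / (1 + \<theta>) + \<theta>\<^sup>2 / (1 + \<theta>)\<^sup>2"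
  shows "(1 + 2 * \<gamma>) * (1 + 2 * \<gamma> * \<theta>) \<le> \<theta>"
proof -
  have clear: "(p / q + s / q\<^sup>2) * q\<^sup>2 = p * q + s" if "q \<noteq> 0" for p q s :: real
    using that by (simp add: distrib_right power2_eq_square)
  have "(1 + 2 * \<gamma> + 2 * \<gamma> * \<theta>\<^sup>2 / (1 + \<theta>)\<^sup>2) * (1 + \<theta>)\<^sup>2
      \<le> (\<theta> / (1 + \<theta>) + \<theta>\<^sup>2 / (1 + \<theta>)\<^sup>2) * (1 + \<theta>)\<^sup>2"
    using cond by (intro mult_right_mono) auto
  also have "\<dots> = \<theta> * (1 + \<theta>) + \<theta>\<^sup>2"
    using assms(1) by (intro clear) auto
  also have "(1 + 2 * \<gamma> + 2 * \<gamma> * \<theta>\<^sup>2 / (1 + \<theta>)\<^sup>2) * (1 + \<theta>)\<^sup>2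
      = (1 + 2 * \<gamma>) * (1 + \<theta>)\<^sup>2 + 2 * \<gamma> * \<theta>\<^sup>2"
    using assms(1) by (simp add: distrib_right)
  finally have c: "2 * \<gamma> * (2 * \<theta>\<^sup>2 + 2 * \<theta> + 1) \<le> \<theta>\<^sup>2 - \<theta> - 1"
    by (simp add: algebra_simps power2_eq_square)
  have q: "2 * \<theta>\<^sup>2 + 2 * \<theta> + 1 > 0" using assms(1) by (simp add: add_pos_pos)
  have "2 * \<gamma> * (2 * \<theta>\<^sup>2 + 2 * \<theta> + 1) \<le> 1 / 2 * (2 * \<theta>\<^sup>2 + 2 * \<theta> + 1)"
    using c assms(1) by simp
  then have h: "2 * \<gamma> \<le> 1 / 2"
    using q mult_le_cancel_right_pos by blast
  have "0 < 2 * \<gamma> * (2 * \<theta>\<^sup>2 + 2 * \<theta> + 1)" using assms(2) q by simp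
  then have r: "\<theta>\<^sup>2 > \<theta> + 1" using c by linarith
  then have t: "\<theta> > 3 / 2"
  proof -
    have "\<not> \<theta> \<le> 3 / 2"
    proof
      assume "\<theta> \<le> 3 / 2"
      then have "\<theta> * \<theta> \<le> 3 / 2 * \<theta>" using assms(1) by (intro mult_right_mono) auto
      then show False using r \<open>\<theta> \<le> 3 / 2\<close> by (simp add: power2_eq_square)
    qed
    then show ?thesis by simp
  qed
  have "2 * \<gamma> * \<theta> * 3 * (2 * \<theta>\<^sup>2 + 2 * \<theta> + 1) \<le> 3 * \<theta> * (\<theta>\<^sup>2 - \<theta> - 1)"
    using mult_left_mono[OF c, of "3 * \<theta>"] assms(1) by (simp add: algebra_simps)
  \<comment> \<open>Right side minus left side is
    \<open>\<theta>^3 + \<theta>^2 - \<theta> - 3\<close>, at least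
    \<open>2 * \<theta>^2 - 3\<close> by \<open>r\<close>, hence positive.\<close>
  also have "\<dots> \<le> (2 * \<theta> - 3) * (2 * \<theta>\<^sup>2 + 2 * \<theta> + 1)"
  proof -
    have "\<theta> * \<theta>\<^sup>2 \<ge> \<theta> * (\<theta> + 1)" using r assms(1) by (intro mult_left_mono) auto
    then show ?thesis using r t by (simp add: algebra_simps power2_eq_square)
  qed
  finally have "2 * \<gamma> * \<theta> * 3 \<le> 2 * \<theta> - 3"
    using q mult_le_cancel_right_pos by blast
  then have "3 / 2 * (1 + 2 * \<gamma> * \<theta>) \<le> \<theta>" by simp
  moreover have "(1 + 2 * \<gamma>) * (1 + 2 * \<gamma> * \<theta>) \<le> 3 / 2 * (1 + 2 * \<gamma> * \<theta>)"
    using h assms by (intro mult_right_mono) auto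
  ultimately show ?thesis by linarith
qed

text \<open>Polarization of \<open>w \<bullet> b\<close> leaves a negative multiple of the squared
  norm of \<open>w\<close>. It absorbs the squared norm of \<open>r *\<^sub>R (w + d)\<close>:
  \<open>par\<close> supplies the constant, and \<open>r \<le> 1 + \<gamma>\<close> turns the factor
  \<open>r\<^sup>2 / (1 + \<gamma>)\<close> into \<open>r\<close>.\<close>

lemma gradient_cross_term_bound:
  fixes b d w :: "'a::real_inner" and \<theta> \<gamma> r :: real
  assumes "\<theta> > 0" "\<gamma> > 0" "0 < r" "r \<le> 1 + \<gamma>"
    and par: "(1 + 2 * \<gamma>) * (1 + 2 * \<gamma> * \<theta>) \<le> \<theta>"
  shows "(1 / 2 + \<gamma> * \<theta>) * (norm (r *\<^sub>R (w + d)))\<^sup>2 - \<theta> * (r *\<^sub>R (w + d) \<bullet> b)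
    \<le> \<gamma> * \<theta> / 2 * (norm b)\<^sup>2 + \<theta> * r / 2 * (norm (w - b))\<^sup>2 + \<theta> / \<gamma> * r\<^sup>2 * (norm d)\<^sup>2"
proof -
  define A where "A = 1 / 2 + \<gamma> * \<theta>"
  \<comment> \<open>The weights make the coefficient of \<open>b \<bullet> b\<close> equal to the
    one in the potential.\<close>
  have "0 \<le> \<theta> / (2 * \<gamma>) * (norm (\<gamma> *\<^sub>R b + r *\<^sub>R d))\<^sup>2" using assms by simp
  also have "\<dots> = \<gamma> * \<theta> / 2 * (b \<bullet> b) + \<theta> * r * (d \<bullet> b) + \<theta> / (2 * \<gamma>) * r\<^sup>2 * (d \<bullet> d)"
    unfolding power2_norm_eq_inner using assms
    by (simp add: inner_commute algebra_simps power2_eq_square)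
  finally have y1: "- (\<theta> * r * (d \<bullet> b)) \<le> \<gamma> * \<theta> / 2 * (b \<bullet> b) + \<theta> / (2 * \<gamma>) * r\<^sup>2 * (d \<bullet> d)"
    by simp
  \<comment> \<open>With these weights the factor \<open>1 + 2 * \<gamma>\<close> can be pulled out
    of both resulting coefficients.\<close>
  have "0 \<le> (norm (\<gamma> *\<^sub>R w - (1 + \<gamma>) *\<^sub>R d))\<^sup>2 / (\<gamma> * (1 + \<gamma>))" using assms by simp
  also have "\<dots> = \<gamma> / (1 + \<gamma>) * (w \<bullet> w) + (1 + \<gamma>) / \<gamma> * (d \<bullet> d) - 2 * (w \<bullet> d)"
  proof -
    have "(norm (\<gamma> *\<^sub>R w - (1 + \<gamma>) *\<^sub>R d))\<^sup>2
        = \<gamma>\<^sup>2 * (w \<bullet> w) + (1 + \<gamma>)\<^sup>2 * (d \<bullet> d) - 2 * \<gamma> * (1 + \<gamma>) * (w \<bullet> d)"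
      unfolding power2_norm_eq_inner
      by (simp add: inner_commute algebra_simps power2_eq_square)
    then show ?thesis using assms by (simp add: divide_simps power2_eq_square)
  qed
  finally have "(w + d) \<bullet> (w + d) \<le> (1 + \<gamma> / (1 + \<gamma>)) * (w \<bullet> w) + (1 + (1 + \<gamma>) / \<gamma>) * (d \<bullet> d)"
    by (simp add: inner_commute algebra_simps)
  also have "\<dots> = (1 + 2 * \<gamma>) * ((w \<bullet> w) / (1 + \<gamma>) + (d \<bullet> d) / \<gamma>)"
    using assms by (simp add: divide_simps) (simp add: algebra_simps)
  finally have "A * ((w + d) \<bullet> (w + d)) \<le> A * ((1 + 2 * \<gamma>) * ((w \<bullet> w) / (1 + \<gamma>) + (d \<bullet> d) / \<gamma>))"
    using assms by (intro mult_left_mono) (auto simp: A_def)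
  also have "\<dots> \<le> \<theta> / 2 * ((w \<bullet> w) / (1 + \<gamma>) + (d \<bullet> d) / \<gamma>)"
  proof -
    have "A * (1 + 2 * \<gamma>) \<le> \<theta> / 2" using par by (simp add: A_def algebra_simps)
    then show ?thesis unfolding mult.assoc[symmetric] using assms by (intro mult_right_mono) auto
  qed
  finally have "r\<^sup>2 * (A * ((w + d) \<bullet> (w + d))) \<le> r\<^sup>2 * (\<theta> / 2 * ((w \<bullet> w) / (1 + \<gamma>) + (d \<bullet> d) / \<gamma>))"
    by (intro mult_left_mono) auto
  also have "\<dots> = \<theta> / 2 * (w \<bullet> w) * (r * r / (1 + \<gamma>)) + \<theta> / (2 * \<gamma>) * r\<^sup>2 * (d \<bullet> d)"
    by (simp add: algebra_simps power2_eq_square)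
  also have "\<dots> \<le> \<theta> / 2 * (w \<bullet> w) * r + \<theta> / (2 * \<gamma>) * r\<^sup>2 * (d \<bullet> d)"
  proof -
    have "r * r / (1 + \<gamma>) \<le> r"
      using mult_left_mono[of r "1 + \<gamma>" r] assms by (simp add: pos_divide_le_eq)
    then show ?thesis using assms by (intro add_right_mono mult_left_mono) auto
  qed
  finally have y2: "r\<^sup>2 * (A * ((w + d) \<bullet> (w + d)))
      \<le> \<theta> / 2 * (w \<bullet> w) * r + \<theta> / (2 * \<gamma>) * r\<^sup>2 * (d \<bullet> d)" .
  \<comment> \<open>This part of the polarization identity is discarded.\<close>
  have y3: "0 \<le> \<theta> * r / 2 * (b \<bullet> b)" using assms by simp
  have "\<theta> / (2 * \<gamma>) * r\<^sup>2 * (d \<bullet> d) + \<theta> / (2 * \<gamma>) * r\<^sup>2 * (d \<bullet> d) = \<theta> / \<gamma> * r\<^sup>2 * (d \<bullet> d)"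
    by simp
  moreover have "\<theta> * r / 2 * ((w - b) \<bullet> (w - b))
      = \<theta> / 2 * (w \<bullet> w) * r + \<theta> * r / 2 * (b \<bullet> b) - \<theta> * r * (w \<bullet> b)"
    by (simp add: inner_commute algebra_simps)
  moreover have "\<theta> * (r *\<^sub>R (w + d) \<bullet> b) = \<theta> * r * (w \<bullet> b) + \<theta> * r * (d \<bullet> b)"
    by (simp add: algebra_simps)
  moreover have "A * (r *\<^sub>R (w + d) \<bullet> r *\<^sub>R (w + d)) = r\<^sup>2 * (A * ((w + d) \<bullet> (w + d)))"
    by (simp add: power2_eq_square)
  ultimately show ?thesis
    using y1 y2 y3 unfolding power2_norm_eq_inner A_def[symmetric] by linarith
qed

text \<open>Solving \<open>z\<close> for \<open>xh\<close> writes \<open>x - xh\<close> as a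
  combination of \<open>x - z\<close> and \<open>y - z\<close>. Linearizing \<open>f\<close> at
  \<open>z\<close> in both directions, the divergence at \<open>x\<close> is dropped and the one at
  \<open>y\<close> is kept as the gain.\<close>

lemma extrapolated_step_descent:
  fixes f :: "'a::real_inner \<Rightarrow> real" and y z v x xh :: 'a
  assumes cvx: "convex_on UNIV f" and nonneg: "0 \<le> bregman f x z"
    and pos: "0 < \<eta>" "0 < \<alpha>" "0 < H + \<eta>" and le: "\<eta> / (\<alpha> * (H + \<eta>)) \<le> 1"
    and z: "z = \<alpha> *\<^sub>R xh + (1 - \<alpha>) *\<^sub>R y"
  defines "g \<equiv> gradient f z" and "\<beta> \<equiv> \<eta> / (\<alpha> * (H + \<eta>))"
  shows "1 / 2 * (norm (v - \<eta> *\<^sub>R g - x))\<^sup>2 + (H + \<eta>) * (f (\<beta> *\<^sub>R z + (1 - \<beta>) *\<^sub>R y) - f x)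
    \<le> 1 / 2 * (norm (v - x))\<^sup>2 + H * (f y - f x) + 1 / 2 * (norm (\<eta> *\<^sub>R g))\<^sup>2
      + \<eta> * (g \<bullet> (xh - v)) - \<eta> * ((1 - \<alpha>) / \<alpha>) * bregman f y z"
proof -
  have "x - xh = (x - z) + ((1 - \<alpha>) / \<alpha>) *\<^sub>R (y - z)"
  proof -
    have "y - z = \<alpha> *\<^sub>R (y - xh)" by (simp add: z algebra_simps)
    then have "((1 - \<alpha>) / \<alpha>) *\<^sub>R (y - z) = (1 - \<alpha>) *\<^sub>R (y - xh)" using pos by simp
    then show ?thesis by (simp add: z algebra_simps)
  qed
  then have "\<eta> * (g \<bullet> (x - xh))
      = \<eta> * (g \<bullet> (x - z)) + \<eta> * ((1 - \<alpha>) / \<alpha>) * (g \<bullet> (y - z))"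
    by (simp only: inner_add_right inner_scaleR_right distrib_left mult.assoc)
  also have "g \<bullet> (y - z) = f y - f z - bregman f y z" by (simp add: bregman_def g_def)
  also have "g \<bullet> (x - z) = f x - f z - bregman f x z" by (simp add: bregman_def g_def)
  finally have gx: "\<eta> * (g \<bullet> (x - xh)) \<le> \<eta> * (f x - f z)
      + \<eta> * ((1 - \<alpha>) / \<alpha>) * (f y - f z) - \<eta> * ((1 - \<alpha>) / \<alpha>) * bregman f y z"
    using nonneg pos by (simp add: right_diff_distrib)
  have "0 \<le> \<beta>" "\<beta> \<le> 1"
    using pos le by (simp_all add: \<beta>_def)
  then have "f (\<beta> *\<^sub>R z + (1 - \<beta>) *\<^sub>R y) \<le> \<beta> * f z + (1 - \<beta>) * f y"
    using cvx by (auto simp: convex_on_def)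
  then have "(H + \<eta>) * f (\<beta> *\<^sub>R z + (1 - \<beta>) *\<^sub>R y) \<le> (H + \<eta>) * (\<beta> * f z + (1 - \<beta>) * f y)"
    using pos by (intro mult_left_mono) auto
  also have "\<dots> = (H + \<eta>) * \<beta> * (f z - f y) + (H + \<eta>) * f y" by (simp add: algebra_simps)
  \<comment> \<open>This identity is what \<beta> is chosen for: it makes all occurrences of
    \<open>f z\<close> cancel in the final sum.\<close>
  also have "(H + \<eta>) * \<beta> = \<eta> / \<alpha>" using pos by (simp add: \<beta>_def)
  finally have fy: "(H + \<eta>) * f (\<beta> *\<^sub>R z + (1 - \<beta>) *\<^sub>R y) \<le> \<eta> / \<alpha> * (f z - f y) + (H + \<eta>) * f y" .
  have al: "\<eta> * ((1 - \<alpha>) / \<alpha>) = \<eta> / \<alpha> - \<eta>" using pos by (simp add: field_simps)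
  have "1 / 2 * (norm (v - \<eta> *\<^sub>R g - x))\<^sup>2
      = 1 / 2 * (norm (v - x))\<^sup>2 + 1 / 2 * (norm (\<eta> *\<^sub>R g))\<^sup>2 + \<eta> * (g \<bullet> (xh - v)) + \<eta> * (g \<bullet> (x - xh))"
    unfolding power2_norm_eq_inner by (simp add: inner_commute algebra_simps)
  then show ?thesis using gx fy unfolding al by (simp add: algebra_simps)
qed

section \<open>One step of the algorithm and its invariant\<close>

lemma graal_step_sel:
  fixes s :: "'a::real_inner graal_state"
  shows "it_x (graal_step f \<theta> \<gamma> \<nu> s) = it_x s - it_eta s *\<^sub>R gradient f (it_xtilde s)"
    and "it_xbar (graal_step f \<theta> \<gamma> \<nu> s)
      = it_beta s *\<^sub>R it_xtilde s + (1 - it_beta s) *\<^sub>R it_xbar s"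
    and "it_alpha (graal_step f \<theta> \<gamma> \<nu> s)
      = (1 + \<gamma>) * it_eta s / (it_H s + (1 + \<gamma>) * it_eta s)"
    and "it_xtilde (graal_step f \<theta> \<gamma> \<nu> s) =
      it_alpha (graal_step f \<theta> \<gamma> \<nu> s) *\<^sub>R
        (it_x (graal_step f \<theta> \<gamma> \<nu> s) + \<theta> *\<^sub>R (it_x (graal_step f \<theta> \<gamma> \<nu> s) - it_x s))
      + (1 - it_alpha (graal_step f \<theta> \<gamma> \<nu> s)) *\<^sub>R it_xbar (graal_step f \<theta> \<gamma> \<nu> s)"
    and "it_lambda (graal_step f \<theta> \<gamma> \<nu> s) =
      min (curvature f (it_xbar (graal_step f \<theta> \<gamma> \<nu> s)) (it_xtilde s))
        (curvature f (it_xbar (graal_step f \<theta> \<gamma> \<nu> s)) (it_xtilde (graal_step f \<theta> \<gamma> \<nu> s)))"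
    and "it_eta (graal_step f \<theta> \<gamma> \<nu> s) =
      real_of_ereal (min (ereal ((1 + \<gamma>) * it_eta s))
        (ereal (\<nu> * it_H_prev s) * it_lambda (graal_step f \<theta> \<gamma> \<nu> s) / ereal (it_eta_prev s)))"
    and "it_H (graal_step f \<theta> \<gamma> \<nu> s) = it_H s + it_eta (graal_step f \<theta> \<gamma> \<nu> s)"
    and "it_beta (graal_step f \<theta> \<gamma> \<nu> s) = it_eta (graal_step f \<theta> \<gamma> \<nu> s) /
      (it_alpha (graal_step f \<theta> \<gamma> \<nu> s) * it_H (graal_step f \<theta> \<gamma> \<nu> s))"
    and "it_eta_prev (graal_step f \<theta> \<gamma> \<nu> s) = it_eta s"
    and "it_H_prev (graal_step f \<theta> \<gamma> \<nu> s) = it_H s"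
  by (simp_all only: graal_step_def Let_def graal_state.select_convs)

text \<open>
  The bound on \<open>it_H_prev s / it_eta_prev s\<close> transfers the stepsize rule, which involves
  \<open>H\<^bsub>k-2\<^esub> / \<eta>\<^bsub>k-2\<^esub>\<close>, to the ratio \<open>H\<^bsub>k-1\<^esub> / \<eta>\<^bsub>k-1\<^esub>\<close> appearing in the descent estimate.
\<close>

definition admissible :: "real \<Rightarrow> 'a graal_state \<Rightarrow> bool" where
  "admissible \<gamma> s \<longleftrightarrow> 0 < it_eta s \<and> it_eta s \<le> it_H s \<and> 0 < it_eta_prev s \<and> 0 < it_H_prev s
    \<and> it_H_prev s / it_eta_prev s \<le> (1 + \<gamma>) * (it_H s / it_eta s)
    \<and> 0 \<le> it_beta s \<and> it_beta s \<le> 1"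

lemma admissible_init: "0 < \<eta> \<Longrightarrow> 0 < \<gamma> \<Longrightarrow> admissible \<gamma> (graal_init x \<eta>)"
  by (simp add: admissible_def graal_init_def)

text \<open>The growth cap on the stepsize yields the ratio bound, because \<open>it_H\<close>
  increases, and also \<open>it_beta t \<le> 1\<close>. The curvature branch of the minimum yields
  the bound involving \<open>it_lambda t\<close>.\<close>

lemma graal_step_bounds:
  fixes f :: "'a::euclidean_space \<Rightarrow> real" and \<theta> :: real
  assumes cvx: "convex_on UNIV f" and diff: "\<And>u. f differentiable (at u)"
    and pos: "0 < \<gamma>" "0 < \<nu>" and adm: "admissible \<gamma> s"
  defines "t \<equiv> graal_step f \<theta> \<gamma> \<nu> s"
  shows "0 < it_lambda t" and "0 < it_eta t" and "it_eta t \<le> (1 + \<gamma>) * it_eta s"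
    and "it_eta t * real_of_ereal (1 / it_lambda t) \<le> \<nu> * (it_H_prev s / it_eta_prev s)"
    and "0 \<le> real_of_ereal (1 / it_lambda t)"
    and "admissible \<gamma> t"
proof -
  have adm': "0 < it_eta s" "it_eta s \<le> it_H s" "0 < it_eta_prev s" "0 < it_H_prev s"
    using adm by (auto simp: admissible_def)
  show lam: "0 < it_lambda t"
    by (simp add: t_def graal_step_sel curvature_pos[OF cvx diff])
  have "ereal (\<nu> * it_H_prev s) * it_lambda t / ereal (it_eta_prev s)
      = ereal (\<nu> * (it_H_prev s / it_eta_prev s)) * it_lambda t"
    using adm' pos lam by (cases "it_lambda t") auto
  then have eta: "it_eta t = real_of_ereal (min (ereal ((1 + \<gamma>) * it_eta s))
      (ereal (\<nu> * (it_H_prev s / it_eta_prev s)) * it_lambda t))"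
    unfolding t_def by (subst graal_step_sel(6)) simp
  have c: "0 < \<nu> * (it_H_prev s / it_eta_prev s)" and p: "0 < (1 + \<gamma>) * it_eta s"
    using adm' pos by auto
  note bounds = stepsize_bounds[OF lam c p, folded eta]
  show eta_pos: "0 < it_eta t" and eta_le: "it_eta t \<le> (1 + \<gamma>) * it_eta s"
    and "it_eta t * real_of_ereal (1 / it_lambda t) \<le> \<nu> * (it_H_prev s / it_eta_prev s)"
    and "0 \<le> real_of_ereal (1 / it_lambda t)"
    using bounds by auto
  have H: "it_H t = it_H s + it_eta t" "it_eta_prev t = it_eta s" "it_H_prev t = it_H s"
    by (simp_all add: t_def graal_step_sel)
  have "it_H s * it_eta t \<le> it_H s * ((1 + \<gamma>) * it_eta s)"
    using eta_le adm' by (intro mult_left_mono) auto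
  then have ratio: "it_H s / it_eta s \<le> (1 + \<gamma>) * (it_H s / it_eta t)"
    using eta_pos adm' by (simp add: field_simps)
  also have "\<dots> \<le> (1 + \<gamma>) * (it_H t / it_eta t)"
    using eta_pos pos by (intro mult_left_mono divide_right_mono) (auto simp: H)
  finally have ratio: "it_H s / it_eta s \<le> (1 + \<gamma>) * (it_H t / it_eta t)" .
  have alpha: "it_alpha t = (1 + \<gamma>) * it_eta s / (it_H s + (1 + \<gamma>) * it_eta s)"
    by (simp add: t_def graal_step_sel)
  \<comment> \<open>This is \<open>it_beta t \<le> 1\<close> with denominators cleared; the product
    \<open>(1 + \<gamma>) * it_eta s * it_eta t\<close> occurs on both sides.\<close>
  have "it_eta t * (it_H s + (1 + \<gamma>) * it_eta s) \<le> (1 + \<gamma>) * it_eta s * (it_H s + it_eta t)"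
    using mult_left_mono[OF eta_le, of "it_H s"] adm' by (simp add: algebra_simps)
  then have "it_eta t \<le> it_alpha t * it_H t"
    using adm' p by (simp add: alpha H divide_simps add_pos_pos)
  moreover have beta: "it_beta t = it_eta t / (it_alpha t * it_H t)"
    unfolding t_def by (rule graal_step_sel)
  moreover from calculation have "0 < it_alpha t * it_H t" using eta_pos by linarith
  ultimately have "0 \<le> it_beta t" "it_beta t \<le> 1"
    using eta_pos by (simp_all add: pos_divide_le_eq)
  then show "admissible \<gamma> t"
    using adm' eta_pos ratio by (auto simp: admissible_def H)
qed

section \<open>Descent of the potential\<close>

theorem theorem1:
  fixes f :: "'a::euclidean_space \<Rightarrow> real"
    and \<theta> \<gamma> \<nu> \<eta>0 :: real
    and x0 x :: 'a
    and K k :: nat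
    and S :: "nat \<Rightarrow> 'a graal_state"
  assumes "convex_on UNIV f"
    and "f differentiable_on UNIV"
    and "continuous_on UNIV (gradient f)"
    and "\<exists>xmin. \<forall>y. f xmin \<le> f y"
    and "\<theta> > 0" and "\<gamma> > 0" and "\<nu> > 0"
    and "4 * \<nu> * \<theta> * (1 + \<gamma>)\<^sup>2 = \<gamma>"
    and "1 + 2 * \<gamma> + 2 * \<gamma> * \<theta>\<^sup>2 / (1 + \<theta>)\<^sup>2 \<le> \<theta> / (1 + \<theta>) + \<theta>\<^sup>2 / (1 + \<theta>)\<^sup>2"
    and "\<eta>0 > 0"
    and "K \<ge> 1"
    and "S = graal f \<theta> \<gamma> \<nu> x0 \<eta>0"
    and "k \<in> {1..K - 1}"
  shows "graal_potential f \<theta> \<gamma> S (k + 1) x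
    \<le> graal_potential f \<theta> \<gamma> S k x
      - \<gamma> * \<theta> / 2 * (it_eta (S k))\<^sup>2 * (norm (gradient f (it_xtilde (S k))))\<^sup>2
      - 1 / (4 * (1 + \<gamma>)) * it_eta (S k) * bregman f (it_xbar (S k)) (it_xtilde (S k))"
proof -
  note cvx = \<open>convex_on UNIV f\<close>
  have diff: "f differentiable (at u)" for u
    using \<open>f differentiable_on UNIV\<close> by (simp add: differentiable_on_def)
  note pos = \<open>\<theta> > 0\<close> \<open>\<gamma> > 0\<close> \<open>\<nu> > 0\<close>
  note nonneg = bregman_nonneg[OF cvx diff]
  note bounds = graal_step_bounds[OF cvx diff \<open>\<gamma> > 0\<close> \<open>\<nu> > 0\<close>]
  have S_Suc: "S (Suc i) = graal_step f \<theta> \<gamma> \<nu> (S i)" for i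
    by (simp add: \<open>S = _\<close>)
  have adm: "admissible \<gamma> (S i)" for i
    by (induction i) (auto simp: S_Suc bounds, simp add: \<open>S = _\<close> admissible_init \<open>\<eta>0 > 0\<close> pos)
  \<comment> \<open>Since \<open>k\<close> is positive, \<open>it_lambda (S k)\<close> is produced
    by a step and is not the dummy of the initial state.\<close>
  obtain j where k: "k = Suc j"
    using \<open>k \<in> _\<close> by (cases k) auto
  define s t u where "s = S j" and "t = S k" and "u = S (k + 1)"
  have t: "t = graal_step f \<theta> \<gamma> \<nu> s" and u: "u = graal_step f \<theta> \<gamma> \<nu> t"
    by (simp_all add: s_def t_def u_def k S_Suc)
  have adm_s: "admissible \<gamma> s" and adm_t: "admissible \<gamma> t"
    by (simp_all add: s_def t_def adm)
  note t_bounds = bounds[OF adm_s, of \<theta>, folded t] and u_bounds = bounds[OF adm_t, of \<theta>, folded u]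
  note t_sel = graal_step_sel[of f \<theta> \<gamma> \<nu> s, folded t]
    and u_sel = graal_step_sel[of f \<theta> \<gamma> \<nu> t, folded u]
  define \<eta> \<eta>' h Ds Dt lt lu where "\<eta> = it_eta s" and "\<eta>' = it_eta t" and "h = it_H s / it_eta s"
    and "Ds = bregman f (it_xbar s) (it_xtilde s)" and "Dt = bregman f (it_xbar t) (it_xtilde t)"
    and "lt = real_of_ereal (1 / it_lambda t)" and "lu = real_of_ereal (1 / it_lambda u)"
  define gs gt gw where "gs = gradient f (it_xtilde s)" and "gt = gradient f (it_xtilde t)"
    and "gw = gradient f (it_xbar t)"
  have eta: "0 < \<eta>" "0 < \<eta>'" "\<eta>' \<le> (1 + \<gamma>) * \<eta>"
    using t_bounds adm_s by (auto simp: \<eta>_def \<eta>'_def admissible_def)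
  have h: "1 \<le> h" using adm_s by (simp add: h_def admissible_def)
  have lt: "0 \<le> lt" using t_bounds by (simp add: lt_def)
  have Dt: "0 \<le> Dt" using nonneg by (simp add: Dt_def)

  \<comment> \<open>The two arguments of the minimum defining \<open>it_lambda t\<close> serve
    \<open>e_s\<close> and \<open>e_t\<close> respectively.\<close>
  have "(norm (gw - gs))\<^sup>2 \<le> 2 * lt * bregman f (it_xbar t) (it_xtilde s)"
    unfolding gw_def gs_def lt_def
    by (intro norm_gradient_diff_le[OF cvx diff t_bounds(1)]) (simp add: t_sel(5))
  also have "\<dots> \<le> 2 * lt * Ds"
    unfolding t_sel(2) Ds_def using adm_s nonneg lt
    by (intro mult_left_mono bregman_convex_le[OF cvx]) (auto simp: admissible_def)
  finally have e_s: "(norm (gw - gs))\<^sup>2 \<le> 2 * lt * Ds" .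
  have e_t: "(norm (gw - gt))\<^sup>2 \<le> 2 * lt * Dt"
    unfolding gw_def gt_def lt_def Dt_def
    by (intro norm_gradient_diff_le[OF cvx diff t_bounds(1)]) (simp add: t_sel(5))

  \<comment> \<open>The rule for \<eta>' reads a ratio one index before \<open>h\<close>, at the
    cost of a factor \<open>1 + \<gamma>\<close>; the rule for \<open>it_eta u\<close> reads
    \<open>h\<close> itself.\<close>
  have "\<nu> * (it_H_prev s / it_eta_prev s) \<le> \<nu> * ((1 + \<gamma>) * h)"
    using adm_s pos unfolding h_def by (intro mult_left_mono) (auto simp: admissible_def)
  then have lt_le: "\<eta>' * lt \<le> \<nu> * ((1 + \<gamma>) * h)"
    using t_bounds(4) by (simp add: \<eta>'_def lt_def)
  have lu_le: "it_eta u * lu \<le> \<nu> * h"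
    using u_bounds(4) by (simp add: lu_def t_sel h_def)
  have nu: "\<theta> * \<nu> = \<gamma> / (4 * (1 + \<gamma>)\<^sup>2)"
    using \<open>4 * \<nu> * \<theta> * (1 + \<gamma>)\<^sup>2 = \<gamma>\<close> pos by (simp add: field_simps)
  have "\<gamma> / (1 + \<gamma>) * (1 / (4 * (1 + \<gamma>))) \<le> 1 * (1 / (4 * (1 + \<gamma>)))"
    using pos by (intro mult_right_mono) auto
  then have nu_le: "\<theta> * \<nu> \<le> 1 / (4 * (1 + \<gamma>))"
    unfolding nu by (simp add: power2_eq_square mult_ac)

  define a b where "a = \<eta>' *\<^sub>R gt" and "b = \<eta> *\<^sub>R gs"
  define r where "r = \<eta>' / \<eta>"
  have r: "0 < r" "r \<le> 1 + \<gamma>" "r * \<eta> = \<eta>'" using eta by (simp_all add: r_def field_simps)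
  \<comment> \<open>The gradient at \<open>it_xbar t\<close> is inserted, with \<eta> kept inside so
    that the first summand is comparable to \<open>b\<close>.\<close>
  have a_eq: "a = r *\<^sub>R (\<eta> *\<^sub>R gw + \<eta> *\<^sub>R (gt - gw))"
    using r by (simp add: a_def algebra_simps)
  have "(1 / 2 + \<gamma> * \<theta>) * (norm a)\<^sup>2 - \<theta> * (a \<bullet> b)
      \<le> \<gamma> * \<theta> / 2 * (norm b)\<^sup>2 + \<theta> * r / 2 * (norm (\<eta> *\<^sub>R gw - b))\<^sup>2
        + \<theta> / \<gamma> * r\<^sup>2 * (norm (\<eta> *\<^sub>R (gt - gw)))\<^sup>2"
    unfolding a_eq using pos r parameter_bound[OF pos(1,2) assms(9)]
    by (intro gradient_cross_term_bound) auto
  also have "\<theta> * r / 2 * (norm (\<eta> *\<^sub>R gw - b))\<^sup>2 = \<theta> * \<eta> * \<eta>' / 2 * (norm (gw - gs))\<^sup>2"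
    by (simp add: b_def power_mult_distrib power2_eq_square flip: r(3) scaleR_diff_right)
  also have "\<dots> \<le> \<theta> * \<eta> * \<eta>' / 2 * (2 * lt * Ds)"
    using e_s pos eta by (intro mult_left_mono) auto
  also have "\<theta> / \<gamma> * r\<^sup>2 * (norm (\<eta> *\<^sub>R (gt - gw)))\<^sup>2 = \<theta> / \<gamma> * \<eta>'\<^sup>2 * (norm (gw - gt))\<^sup>2"
    by (simp add: power_mult_distrib norm_minus_commute flip: r(3))
  also have "\<dots> \<le> \<theta> / \<gamma> * \<eta>'\<^sup>2 * (2 * lt * Dt)"
    using e_t pos eta by (intro mult_left_mono) auto
  also have "\<dots> = \<theta> / \<gamma> * \<eta>' * 2 * Dt * (\<eta>' * lt)"
    by (simp add: power2_eq_square)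
  also have "\<dots> \<le> \<theta> / \<gamma> * \<eta>' * 2 * Dt * (\<nu> * ((1 + \<gamma>) * h))"
    using lt_le pos eta Dt by (intro mult_left_mono) auto
  also have "\<dots> = (\<theta> * \<nu>) * (2 * \<eta>' * Dt * (1 + \<gamma>) * h / \<gamma>)"
    by simp
  also have "\<dots> = 1 / (2 * (1 + \<gamma>)) * (\<eta>' * h * Dt)"
    unfolding nu using pos by (simp add: divide_simps power2_eq_square)
  finally have cross: "(1 / 2 + \<gamma> * \<theta>) * (norm a)\<^sup>2 - \<theta> * (a \<bullet> b)
      \<le> \<gamma> * \<theta> / 2 * (norm b)\<^sup>2 + \<theta> * \<eta>' * \<eta> * lt * Ds + 1 / (2 * (1 + \<gamma>)) * (\<eta>' * h * Dt)"
    by (simp add: mult_ac)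

  have "\<theta> * it_eta u * \<eta>' * lu * Dt = \<theta> * \<eta>' * Dt * (it_eta u * lu)"
    by simp
  also have "\<dots> \<le> \<theta> * \<eta>' * Dt * (\<nu> * h)"
    using lu_le pos eta Dt by (intro mult_left_mono) auto
  also have "\<dots> = (\<theta> * \<nu>) * (\<eta>' * h * Dt)" by simp
  also have "\<dots> \<le> 1 / (4 * (1 + \<gamma>)) * (\<eta>' * h * Dt)"
    using nu_le eta h Dt by (intro mult_right_mono) auto
  finally have new: "\<theta> * it_eta u * \<eta>' * lu * Dt \<le> 1 / (4 * (1 + \<gamma>)) * (\<eta>' * h * Dt)" .
  \<comment> \<open>The claimed decrease carries no factor \<open>h\<close>, so
    \<open>1 \<le> h\<close> suffices.\<close>
  have "1 / (4 * (1 + \<gamma>)) * (\<eta>' * Dt * 1) \<le> 1 / (4 * (1 + \<gamma>)) * (\<eta>' * Dt * h)"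
    using pos eta h Dt by (intro mult_left_mono) auto
  then have rest: "1 / (4 * (1 + \<gamma>)) * \<eta>' * Dt \<le> 1 / (4 * (1 + \<gamma>)) * (\<eta>' * h * Dt)"
    by (simp add: mult_ac)

  have Hs: "0 < it_H s" "it_H t = it_H s + \<eta>'"
    using adm_s by (auto simp: admissible_def t_sel(7) \<eta>'_def)
  have alpha: "0 < it_alpha t" "(1 - it_alpha t) / it_alpha t = h / (1 + \<gamma>)"
  proof -
    define p where "p = (1 + \<gamma>) * \<eta>"
    have p: "0 < p" using eta pos by (simp add: p_def)
    have al: "it_alpha t = p / (it_H s + p)" by (simp add: t_sel(3) p_def \<eta>_def)
    have "1 - p / (it_H s + p) = it_H s / (it_H s + p)"
      using p Hs by (simp add: diff_divide_eq_iff)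
    then have "(1 - it_alpha t) / it_alpha t = it_H s / p"
      unfolding al using p Hs by simp
    then show "(1 - it_alpha t) / it_alpha t = h / (1 + \<gamma>)"
      by (simp add: h_def p_def mult.commute flip: \<eta>_def)
    show "0 < it_alpha t" using p Hs by (simp add: al)
  qed
  have beta: "it_beta t = \<eta>' / (it_alpha t * (it_H s + \<eta>'))"
    using t_sel(8) Hs by (simp add: \<eta>'_def)
  have x_t: "it_x t - it_x s = - b" and x_u: "it_x u - it_x t = - a"
    by (simp_all add: t_sel(1) u_sel(1) a_def b_def gs_def gt_def \<eta>_def \<eta>'_def)
  have x_u': "it_x t - \<eta>' *\<^sub>R gt = it_x u"
    using x_u by (simp add: a_def algebra_simps)
  have "1 / 2 * (norm (it_x u - x))\<^sup>2 + it_H t * (f (it_xbar u) - f x)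
      \<le> 1 / 2 * (norm (it_x t - x))\<^sup>2 + it_H s * (f (it_xbar t) - f x) + 1 / 2 * (norm a)\<^sup>2
        + \<eta>' * (gt \<bullet> (\<theta> *\<^sub>R (it_x t - it_x s))) - \<eta>' * (h / (1 + \<gamma>)) * Dt"
    using extrapolated_step_descent[where x = x and H = "it_H s" and v = "it_x t",
        OF cvx nonneg eta(2) alpha(1) _ _ t_sel(4)] Hs eta adm_t
    by (simp add: beta[symmetric] alpha(2) u_sel(2) x_u' a_def Dt_def admissible_def
        flip: gt_def \<eta>'_def)
  also have "\<eta>' * (gt \<bullet> (\<theta> *\<^sub>R (it_x t - it_x s))) = - (\<theta> * (a \<bullet> b))"
    unfolding x_t by (simp add: a_def)
  also have "\<eta>' * (h / (1 + \<gamma>)) * Dt = 4 * (1 / (4 * (1 + \<gamma>)) * (\<eta>' * h * Dt))"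
    using pos by (simp add: field_simps)
  finally have descent: "1 / 2 * (norm (it_x u - x))\<^sup>2 + it_H t * (f (it_xbar u) - f x)
      \<le> 1 / 2 * (norm (it_x t - x))\<^sup>2 + it_H s * (f (it_xbar t) - f x) + 1 / 2 * (norm a)\<^sup>2
        + - (\<theta> * (a \<bullet> b)) - 4 * (1 / (4 * (1 + \<gamma>)) * (\<eta>' * h * Dt))" .
  \<comment> \<open>The gain in \<open>descent\<close> is \<open>4 * M\<close>: the cross term costs
    \<open>2 * M\<close>, the new Bregman term at most \<open>M\<close>, and the claimed decrease
    \<open>R\<close> at most \<open>M\<close>.\<close>
  define M R where "M = 1 / (4 * (1 + \<gamma>)) * (\<eta>' * h * Dt)"
    and "R = 1 / (4 * (1 + \<gamma>)) * \<eta>' * Dt"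
  have half: "1 / (2 * (1 + \<gamma>)) * (\<eta>' * h * Dt) = 2 * (1 / (4 * (1 + \<gamma>)) * (\<eta>' * h * Dt))"
    using pos by (simp add: field_simps)
  have "graal_potential f \<theta> \<gamma> S (k + 1) x = 1 / 2 * (norm (it_x u - x))\<^sup>2
      + it_H t * (f (it_xbar u) - f x) + \<theta> * it_eta u * \<eta>' * lu * Dt + \<gamma> * \<theta> / 2 * (norm a)\<^sup>2"
    unfolding graal_potential_def add_diff_cancel_right' u_def[symmetric] t_def[symmetric]
    by (simp add: x_u lu_def Dt_def \<eta>'_def)
  moreover have "graal_potential f \<theta> \<gamma> S k x = 1 / 2 * (norm (it_x t - x))\<^sup>2
      + it_H s * (f (it_xbar t) - f x) + \<theta> * \<eta>' * \<eta> * lt * Ds + \<gamma> * \<theta> / 2 * (norm b)\<^sup>2"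
  proof -
    have "k - 1 = j" by (simp add: k)
    then show ?thesis
      unfolding graal_potential_def
      by (simp add: x_t lt_def Ds_def \<eta>'_def \<eta>_def flip: s_def t_def)
  qed
  \<comment> \<open>The first share cancels the error of the distance expansion, the second enters
    the new potential, and the third is the claimed gradient decrease.\<close>
  moreover have "(1 / 2 + \<gamma> * \<theta>) * (norm a)\<^sup>2 = 1 / 2 * (norm a)\<^sup>2
      + \<gamma> * \<theta> / 2 * (norm a)\<^sup>2 + \<gamma> * \<theta> / 2 * (norm a)\<^sup>2"
    by (simp add: algebra_simps)
  moreover have "\<gamma> * \<theta> / 2 * (it_eta t)\<^sup>2 * (norm gt)\<^sup>2 = \<gamma> * \<theta> / 2 * (norm a)\<^sup>2"
    by (simp add: a_def \<eta>'_def power_mult_distrib)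
  ultimately show ?thesis
    using descent cross new rest
    unfolding half t_def[symmetric] gt_def[symmetric] Dt_def[symmetric] \<eta>'_def[symmetric]
      M_def[symmetric] R_def[symmetric]
    by linarith
qed

end
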